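(* Let $1\le p<\infty$ and $0<s<1$. Suppose that $\Omega\subset\mathbb{R}^d$, $\Omega\ne\emptyset$, is an open, uniform, bounded set, and that $0\le\alpha,\beta<\underline{\mathrm{co\,dim}}_A(\partial\Omega)$ and $sp+\alpha+\beta<\underline{\mathrm{co\,dim}}_A(\partial\Omega)$. Then there exists a constant $c$ such that $$\int_\Omega\frac{|f(x)|^p}{d_\Omega(x)^{sp+\alpha+\beta}}\,dx\le c\,\|f\|^p_{W^{s,p;\,\alpha,\beta}(\Omega)}<\infty$$ for all $f\in W^{s,p;\,\alpha,\beta}(\Omega)$.
   Context: Notation: $d_\Omega(x)=\mathrm{dist}(x,\partial\Omega)$; for $E\subset\mathbb{R}^d$ and $r>0$, $\widetilde E_r=\{x\in\mathbb{R}^d:\mathrm{dist}(x,E)\le r\}$. Spaces: $[f]_{W^{s,p;\,\alpha,\beta}(\Omega)}=\left(\int_\Omega\int_\Omega\frac{|f(x)-f(y)|^p}{|x-y|^{d+sp}}d_\Omega(y)^{-\alpha}d_\Omega(x)^{-\beta}\,dy\,dx\right)^{1/p}$ (symmetric under interchanging $\alpha$ and $\beta$); $W^{s,p;\,\alpha,\beta}(\Omega)=\{f\in L^p(\Omega):[f]_{W^{s,p;\,\alpha,\beta}(\Omega)}<\infty\}$ with norm $\|f\|_{W^{s,p;\,\alpha,\beta}(\Omega)}=\|f\|_{L^p(\Omega)}+[f]_{W^{s,p;\,\alpha,\beta}(\Omega)}$. Uniform: a domain (connected open set) $\Omega\subset\mathbb{R}^d$ is uniform if there is a constant $C\ge1$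 such that all $x,y\in\Omega$ can be joined by a curve $\gamma:[0,l]\to\Omega$, parameterized by arc length, with $l\le C|x-y|$ and $\mathrm{dist}(z,\partial\Omega)\ge\frac1C\min\{|z-x|,|z-y|\}$ for all $z\in\gamma$. Lower Assouad codimension: $\underline{\mathrm{co\,dim}}_A(E)$ is the supremum of all $q\ge0$ for which there is $C=C(q)\ge1$ with $|\widetilde E_r\cap B(x,R)|\le C|B(x,R)|(r/R)^q$ for all $x\in E$, $0<r<R<\mathrm{diam}\,E$. *)

theory Defs
  imports "HOL-Analysis.Analysis"
begin

text \<open>The frontier of \<open>\<Omega>\<close> is empty only for the empty set and the whole space; the
  convention \<open>infdist x {} = 0\<close> is then not the usual one (infinite distance). Nonempty bounded
  \<open>\<Omega>\<close> are not affected.\<close>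

definition bdist :: "'a::euclidean_space set \<Rightarrow> 'a \<Rightarrow> real" where
  "bdist \<Omega> x = infdist x (frontier \<Omega>)"

definition tube :: "'a::euclidean_space set \<Rightarrow> real \<Rightarrow> 'a set" where
  "tube E r = {x. infdist x E \<le> r}"

text \<open>Total variation: supremum over all partitions, given as sorted lists.\<close>

definition curve_length :: "(real \<Rightarrow> 'a::metric_space) \<Rightarrow> real \<Rightarrow> real \<Rightarrow> ennreal" where
  "curve_length \<gamma> a b =
     (SUP ts\<in>{ts. sorted ts \<and> set ts \<subseteq> {a..b}}.
        \<Sum>i<length ts - 1. ennreal (dist (\<gamma> (ts ! i)) (\<gamma> (ts ! Suc i))))"

definition arc_length_param :: "(real \<Rightarrow> 'a::metric_space) \<Rightarrow> real \<Rightarrow> bool" where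
  "arc_length_param \<gamma> l \<longleftrightarrow>
     0 \<le> l \<and> continuous_on {0..l} \<gamma> \<and> (\<forall>t\<in>{0..l}. curve_length \<gamma> 0 t = ennreal t)"

definition uniform_domain :: "'a::euclidean_space set \<Rightarrow> bool" where
  "uniform_domain \<Omega> \<longleftrightarrow> open \<Omega> \<and> connected \<Omega> \<and>
     (\<exists>C\<ge>1. \<forall>x\<in>\<Omega>. \<forall>y\<in>\<Omega>. \<exists>l \<gamma>.
        arc_length_param \<gamma> l \<and> \<gamma> ` {0..l} \<subseteq> \<Omega> \<and> \<gamma> 0 = x \<and> \<gamma> l = y \<and>
        l \<le> C * norm (x - y) \<and>
        (\<forall>z\<in>\<gamma> ` {0..l}. bdist \<Omega> z \<ge> 1 / C * min (norm (z - x)) (norm (z - y))))"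

text \<open>The library's \<open>diameter\<close> is meaningful for bounded sets only; an unbounded \<open>E\<close> has
  infinite diameter and so imposes no upper bound on \<open>R\<close>. The supremum may be infinite
  (for a singleton, say), hence \<open>ereal\<close>.\<close>

definition lower_assouad_codim :: "'a::euclidean_space set \<Rightarrow> ereal" where
  "lower_assouad_codim E =
     (SUP q\<in>{q. 0 \<le> q \<and>
        (\<exists>C\<ge>1. \<forall>x\<in>E. \<forall>r R. 0 < r \<and> r < R \<and> (bounded E \<longrightarrow> R < diameter E) \<longrightarrow>
           measure lebesgue (tube E r \<inter> ball x R)
             \<le> C * measure lebesgue (ball x R) * (r / R) powr q)}. ereal q)"

text \<open>Powers of extended nonnegative reals, for exponents \<open>a > 0\<close>.\<close>

definition epowr :: "ennreal \<Rightarrow> real \<Rightarrow> ennreal" where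
  "epowr x a = (if x = \<infinity> then \<infinity> else ennreal (enn2real x powr a))"

definition Lp_norm :: "'a::euclidean_space set \<Rightarrow> real \<Rightarrow> ('a \<Rightarrow> real) \<Rightarrow> ennreal" where
  "Lp_norm \<Omega> p f = epowr (\<integral>\<^sup>+x. ennreal (\<bar>f x\<bar> powr p) \<partial>lebesgue_on \<Omega>) (1 / p)"

definition Lp_space :: "'a::euclidean_space set \<Rightarrow> real \<Rightarrow> ('a \<Rightarrow> real) set" where
  "Lp_space \<Omega> p = {f. f \<in> borel_measurable (lebesgue_on \<Omega>) \<and> Lp_norm \<Omega> p f < \<infinity>}"

definition W_seminorm ::
  "'a::euclidean_space set \<Rightarrow> real \<Rightarrow> real \<Rightarrow> real \<Rightarrow> real \<Rightarrow> ('a \<Rightarrow> real) \<Rightarrow> ennreal" where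
  "W_seminorm \<Omega> s p \<alpha> \<beta> f =
     epowr (\<integral>\<^sup>+x. (\<integral>\<^sup>+y.
         ennreal (\<bar>f x - f y\<bar> powr p / norm (x - y) powr (real DIM('a) + s * p)
           * bdist \<Omega> y powr (- \<alpha>) * bdist \<Omega> x powr (- \<beta>))
       \<partial>lebesgue_on \<Omega>) \<partial>lebesgue_on \<Omega>) (1 / p)"

definition W_space ::
  "'a::euclidean_space set \<Rightarrow> real \<Rightarrow> real \<Rightarrow> real \<Rightarrow> real \<Rightarrow> ('a \<Rightarrow> real) set" where
  "W_space \<Omega> s p \<alpha> \<beta> = {f \<in> Lp_space \<Omega> p. W_seminorm \<Omega> s p \<alpha> \<beta> f < \<infinity>}"

definition W_norm ::
  "'a::euclidean_space set \<Rightarrow> real \<Rightarrow> real \<Rightarrow> real \<Rightarrow> real \<Rightarrow> ('a \<Rightarrow> real) \<Rightarrow> ennreal" where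
  "W_norm \<Omega> s p \<alpha> \<beta> f = Lp_norm \<Omega> p f + W_seminorm \<Omega> s p \<alpha> \<beta> f"

end

theory Submission
  imports Defs
begin

text \<open>Write \<open>d\<close> for the distance to the boundary. For \<open>x\<close> near the boundary, compare \<open>f x\<close> with the values of \<open>f\<close> on the
  points \<open>y\<close> at distance about \<open>M d(x)\<close> from \<open>x\<close> that are at least as deep (\<open>d(y) \<ge> c M d(x)\<close>).
  Following a curve of the uniformity condition from \<open>x\<close> towards a fixed point shows that these
  \<open>y\<close> contain a ball of radius about \<open>M d(x)\<close>. The differences \<open>f x - f y\<close> are controlled by
  the seminorm. Averaging \<open>|f y|\<^sup>p d(x)\<^sup>-\<^sup>\<theta>\<close>, where \<open>\<theta> = sp + \<alpha> + \<beta>\<close>, and exchanging the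
  integrals leaves \<open>|f y|\<^sup>p d(y)\<^sup>-\<^sup>\<theta>\<close> times a multiple of \<open>M\<^sup>\<theta>\<^sup>-\<^sup>q\<close>, because the points
  \<open>x\<close> in question lie in a tube of width about \<open>d(y) / M\<close> inside a ball of radius about \<open>d(y)\<close>,
  and \<open>q > \<theta>\<close> is an exponent in the Assouad condition. For large \<open>M\<close> this term is absorbed into
  the left-hand side.\<close>

section \<open>Absorbing part of a weighted integral into itself\<close>

text \<open>One of \<open>\<bar>a - b\<bar>\<close> and \<open>\<bar>b\<bar>\<close> is at least
  half of \<open>\<bar>a\<bar>\<close>, which gives the constant \<open>2 powr p\<close> without
  convexity.\<close>

lemma powr_abs_le_diff_add:
  fixes a b p :: real
  assumes "0 \<le> p"
  shows "\<bar>a\<bar> powr p \<le> 2 powr p * (\<bar>a - b\<bar> powr p + \<bar>b\<bar> powr p)"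
proof -
  have "\<bar>a\<bar> powr p \<le> (2 * max \<bar>a - b\<bar> \<bar>b\<bar>) powr p"
    using assms by (intro powr_mono2) (auto simp: max_def abs_if)
  also have "\<dots> = 2 powr p * max \<bar>a - b\<bar> \<bar>b\<bar> powr p"
    by (simp add: powr_mult)
  also have "\<dots> \<le> 2 powr p * (\<bar>a - b\<bar> powr p + \<bar>b\<bar> powr p)"
    by (intro mult_left_mono) (auto simp: max_def)
  finally show ?thesis .
qed

text \<open>The spare \<open>G\<close> may be cancelled only because it is finite: for
  \<open>G = \<infinity>\<close> the second hypothesis would hold trivially.\<close>

lemma ennreal_le_twice_of_half_absorbed:
  fixes G H :: ennreal
  assumes "G < \<infinity>" and "2 * G \<le> 2 * H + G"
  shows "G \<le> 2 * H"
proof -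
  have "G + G \<le> 2 * H + G"
    using assms(2) by (simp add: mult_2)
  then show ?thesis
    using assms(1) by (auto simp: ennreal_add_left_cancel_le add.commute)
qed

text \<open>The absorbed term must be finite, which need not be known for the weighted norm itself;
  so the argument is run on \<open>{t < w}\<close>, where \<open>fin\<close> applies. This truncation survives the exchange
  of integrals since the kernel only links \<open>x\<close> to points \<open>y\<close> with \<open>w x \<le> w y\<close>.\<close>

lemma weighted_Lp_absorption:
  fixes f w :: "'b \<Rightarrow> real" and u :: "'b \<Rightarrow> ennreal" and K :: "'b \<Rightarrow> 'b \<Rightarrow> ennreal"
  assumes "sigma_finite_measure M"
    and meas[measurable]: "f \<in> borel_measurable M" "w \<in> borel_measurable M" "u \<in> borel_measurable M"
    and K_meas[measurable]: "case_prod K \<in> borel_measurable (M \<Otimes>\<^sub>M M)"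
    and "0 \<le> p"
    and w_pos: "\<And>x. x \<in> space M \<Longrightarrow> 0 < w x"
    and lower: "\<And>x. x \<in> space M \<Longrightarrow> w x < \<delta> \<Longrightarrow> u x \<le> (\<integral>\<^sup>+y. K x y \<partial>M)"
    and upper: "\<And>y. y \<in> space M \<Longrightarrow> ennreal (2 * 2 powr p) * (\<integral>\<^sup>+x. K x y \<partial>M) \<le> u y"
    and supp: "\<And>x y. x \<in> space M \<Longrightarrow> y \<in> space M \<Longrightarrow> K x y \<noteq> 0 \<Longrightarrow> w x \<le> w y"
    and fin: "\<And>t. 0 < t \<Longrightarrow>
      (\<integral>\<^sup>+x. ennreal (\<bar>f x\<bar> powr p) * u x * indicator {x. t < w x} x \<partial>M) < \<infinity>"
  shows "(\<integral>\<^sup>+x. ennreal (\<bar>f x\<bar> powr p) * u x \<partial>M) \<le>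
    2 * (ennreal (2 powr p) * (\<integral>\<^sup>+x. \<integral>\<^sup>+y. K x y * ennreal (\<bar>f x - f y\<bar> powr p) \<partial>M \<partial>M)
         + (\<integral>\<^sup>+x. ennreal (\<bar>f x\<bar> powr p) * u x * indicator {x. \<delta> \<le> w x} x \<partial>M))"
    (is "_ \<le> 2 * (_ * ?E + ?T)")
proof -
  interpret sigma_finite_measure M by fact
  interpret P: pair_sigma_finite M M ..
  define g where "g = (\<lambda>x. ennreal (\<bar>f x\<bar> powr p))"
  have [measurable]: "g \<in> borel_measurable M"
    unfolding g_def by measurable
  define c where "c = ennreal (2 powr p)"
  define G where "G t = (\<integral>\<^sup>+x. g x * u x * indicator {x. t < w x} x \<partial>M)" for t
  have bound: "G t \<le> 2 * (c * ?E + ?T)" if "0 < t" for t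
  proof (rule ennreal_le_twice_of_half_absorbed)
    show "G t < \<infinity>"
      using fin[OF that] by (simp add: G_def g_def)
    define I where "I = (\<lambda>x. indicator {x. t < w x} x :: ennreal)"
    have [measurable]: "I \<in> borel_measurable M"
      unfolding I_def by measurable
    \<comment> \<open>Where \<open>w x < \<delta>\<close>, the value \<open>g x\<close> is averaged
      against the kernel and replaced by \<open>g y\<close> plus a difference; elsewhere the last
      term takes it over. The truncation \<open>I x\<close> is retained only beside
      \<open>g y\<close>, in the term to be absorbed.\<close>
    have split: "I x * (g x * u x) \<le>
        c * (\<integral>\<^sup>+y. K x y * ennreal (\<bar>f x - f y\<bar> powr p) \<partial>M)
        + c * (\<integral>\<^sup>+y. I x * K x y * g y \<partial>M) + g x * u x * indicator {x. \<delta> \<le> w x} x"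
      if x: "x \<in> space M" for x
    proof (cases "w x < \<delta>")
      case True
      note [measurable] = x
      have "I x * (g x * u x) \<le> I x * (g x * (\<integral>\<^sup>+y. K x y \<partial>M))"
        by (intro mult_left_mono lower x True) auto
      also have "\<dots> = (\<integral>\<^sup>+y. I x * K x y * g x \<partial>M)"
        by (subst nn_integral_multc, measurable)
          (subst nn_integral_cmult, measurable, simp add: ac_simps)
      also have "\<dots> \<le> (\<integral>\<^sup>+y. c * (K x y * ennreal (\<bar>f x - f y\<bar> powr p)) + c * (I x * K x y * g y) \<partial>M)"
      proof (rule nn_integral_mono)
        fix y
        have "g x \<le> c * (ennreal (\<bar>f x - f y\<bar> powr p) + g y)"
          unfolding g_def c_def using powr_abs_le_diff_add[OF \<open>0 \<le> p\<close>, of "f x" "f y"]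
          by (simp add: ennreal_mult[symmetric] ennreal_plus[symmetric] del: ennreal_plus)
        then have "I x * K x y * g x \<le> I x * K x y * (c * (ennreal (\<bar>f x - f y\<bar> powr p) + g y))"
          by (rule mult_left_mono) auto
        also have "\<dots> = I x * (c * (K x y * ennreal (\<bar>f x - f y\<bar> powr p))) + c * (I x * K x y * g y)"
          by (simp add: algebra_simps)
        also have "\<dots> \<le> c * (K x y * ennreal (\<bar>f x - f y\<bar> powr p)) + c * (I x * K x y * g y)"
          by (intro add_right_mono) (auto simp: I_def indicator_def)
        finally show "I x * K x y * g x \<le>
          c * (K x y * ennreal (\<bar>f x - f y\<bar> powr p)) + c * (I x * K x y * g y)" .
      qed
      also have "\<dots> = c * (\<integral>\<^sup>+y. K x y * ennreal (\<bar>f x - f y\<bar> powr p) \<partial>M)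
          + c * (\<integral>\<^sup>+y. I x * K x y * g y \<partial>M)"
        by (subst nn_integral_add, measurable) (simp add: nn_integral_cmult)
      finally show ?thesis
        using True by simp
    next
      case False
      then have "I x * (g x * u x) \<le> g x * u x * indicator {x. \<delta> \<le> w x} x"
        by (auto simp: I_def indicator_def)
      then show ?thesis
        by (simp add: add_increasing)
    qed
    have "(\<integral>\<^sup>+x. \<integral>\<^sup>+y. I x * K x y * g y \<partial>M \<partial>M) = (\<integral>\<^sup>+y. \<integral>\<^sup>+x. I x * K x y * g y \<partial>M \<partial>M)"
      by (rule P.Fubini'[symmetric]) measurable
    also have "\<dots> \<le> (\<integral>\<^sup>+y. I y * g y * (\<integral>\<^sup>+x. K x y \<partial>M) \<partial>M)"
    proof (rule nn_integral_mono)
      fix y assume y: "y \<in> space M"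
      note [measurable] = y
      \<comment> \<open>By \<open>supp\<close>, \<open>t < w x\<close> and
        \<open>K x y \<noteq> 0\<close> force \<open>t < w y\<close>, so the truncation passes from
        \<open>x\<close> to \<open>y\<close>.\<close>
      have "(\<integral>\<^sup>+x. I x * K x y * g y \<partial>M) \<le> (\<integral>\<^sup>+x. I y * g y * K x y \<partial>M)"
        using supp[OF _ y] by (intro nn_integral_mono) (force simp: I_def indicator_def ac_simps)
      also have "\<dots> = I y * g y * (\<integral>\<^sup>+x. K x y \<partial>M)"
        by (rule nn_integral_cmult) measurable
      finally show "(\<integral>\<^sup>+x. I x * K x y * g y \<partial>M) \<le> I y * g y * (\<integral>\<^sup>+x. K x y \<partial>M)" .
    qed
    \<comment> \<open>Doubling matches the factor \<open>2 * 2 powr p\<close> in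
      \<open>upper\<close>: the term to be absorbed is at most half of \<open>G t\<close>.\<close>
    finally have "2 * (c * (\<integral>\<^sup>+x. \<integral>\<^sup>+y. I x * K x y * g y \<partial>M \<partial>M))
        \<le> 2 * (c * (\<integral>\<^sup>+y. I y * g y * (\<integral>\<^sup>+x. K x y \<partial>M) \<partial>M))"
      by (intro mult_left_mono) auto
    also have "\<dots> = (\<integral>\<^sup>+y. I y * g y * (ennreal (2 * 2 powr p) * (\<integral>\<^sup>+x. K x y \<partial>M)) \<partial>M)"
      by (simp add: nn_integral_cmult[symmetric] c_def ennreal_mult ac_simps)
    also have "\<dots> \<le> (\<integral>\<^sup>+y. I y * g y * u y \<partial>M)"
      by (intro nn_integral_mono mult_left_mono upper) auto
    also have "\<dots> = G t"
      by (simp add: G_def I_def ac_simps)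
    finally have main: "2 * (c * (\<integral>\<^sup>+x. \<integral>\<^sup>+y. I x * K x y * g y \<partial>M \<partial>M)) \<le> G t" .
    have "G t = (\<integral>\<^sup>+x. I x * (g x * u x) \<partial>M)"
      by (simp add: G_def I_def ac_simps)
    also have "\<dots> \<le> (\<integral>\<^sup>+x. c * (\<integral>\<^sup>+y. K x y * ennreal (\<bar>f x - f y\<bar> powr p) \<partial>M)
        + c * (\<integral>\<^sup>+y. I x * K x y * g y \<partial>M) + g x * u x * indicator {x. \<delta> \<le> w x} x \<partial>M)"
      by (intro nn_integral_mono split)
    also have "\<dots> = c * ?E + c * (\<integral>\<^sup>+x. \<integral>\<^sup>+y. I x * K x y * g y \<partial>M \<partial>M) + ?T"
      by (simp add: nn_integral_add nn_integral_cmult g_def)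
    finally have "2 * G t \<le> 2 * (c * ?E + c * (\<integral>\<^sup>+x. \<integral>\<^sup>+y. I x * K x y * g y \<partial>M \<partial>M) + ?T)"
      by (rule mult_left_mono) auto
    also have "\<dots> = 2 * (c * ?E + ?T) + 2 * (c * (\<integral>\<^sup>+x. \<integral>\<^sup>+y. I x * K x y * g y \<partial>M \<partial>M))"
      by (simp add: algebra_simps)
    also have "\<dots> \<le> 2 * (c * ?E + ?T) + G t"
      by (intro add_left_mono main)
    finally show "2 * G t \<le> 2 * (c * ?E + ?T) + G t" .
  qed
  \<comment> \<open>The bound does not depend on \<open>t\<close>, and since \<open>w\<close> is
    positive the sets \<open>{x. 1 / Suc n < w x}\<close> exhaust the space, so monotone convergence
    removes the truncation.\<close>
  have "(\<integral>\<^sup>+x. g x * u x \<partial>M) =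
      (\<integral>\<^sup>+x. (SUP n. g x * u x * indicator {x. 1 / Suc n < w x} x) \<partial>M)"
  proof (rule nn_integral_cong)
    fix x assume "x \<in> space M"
    then obtain n where "1 / Suc n < w x"
      using w_pos by (metis nat_approx_posE)
    then have "g x * u x \<le> (SUP n. g x * u x * indicator {x. 1 / Suc n < w x} x)"
      by (intro SUP_upper2[of n]) auto
    moreover have "(SUP n. g x * u x * indicator {x. 1 / Suc n < w x} x) \<le> g x * u x"
      by (intro SUP_least) (auto simp: indicator_def)
    ultimately show "g x * u x = (SUP n. g x * u x * indicator {x. 1 / Suc n < w x} x)"
      by (rule antisym)
  qed
  also have "\<dots> = (SUP n. G (1 / Suc n))"
    unfolding G_def
  proof (rule nn_integral_monotone_convergence_SUP)
    show "incseq (\<lambda>n x. g x * u x * indicator {x. 1 / Suc n < w x} x)"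
    proof (intro incseq_SucI le_funI mult_left_mono)
      fix n x
      have "1 / real (Suc (Suc n)) \<le> 1 / Suc n"
        by (intro divide_left_mono) auto
      then show "indicator {x. 1 / Suc n < w x} x \<le> (indicator {x. 1 / Suc (Suc n) < w x} x :: ennreal)"
        by (auto simp: indicator_def)
    qed auto
  qed measurable
  also have "\<dots> \<le> 2 * (c * ?E + ?T)"
    by (intro SUP_least bound) simp
  finally show ?thesis
    by (simp add: g_def c_def)
qed

section \<open>Distance to the frontier and its diameter\<close>

lemma frontier_bounded_not_empty:
  fixes \<Omega> :: "'a::euclidean_space set"
  assumes "bounded \<Omega>" "\<Omega> \<noteq> {}"
  shows "frontier \<Omega> \<noteq> {}"
  using assms frontier_not_empty[of \<Omega>] not_bounded_UNIV[where 'a='a] by metis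

text \<open>A ball is connected, so one that contains \<open>z\<close> and leaves
  \<open>\<Omega>\<close> would meet the frontier at distance less than \<open>r\<close> from
  \<open>z\<close>.\<close>

lemma ball_bdist_subset:
  assumes "z \<in> \<Omega>" and "r \<le> bdist \<Omega> z"
  shows "ball z r \<subseteq> \<Omega>"
proof (rule ccontr)
  assume "\<not> ball z r \<subseteq> \<Omega>"
  then have "0 < r"
    by (cases "0 < r") (auto simp: ball_empty)
  then have "ball z r \<inter> frontier \<Omega> \<noteq> {}"
    using \<open>\<not> _\<close> \<open>z \<in> \<Omega>\<close> by (intro connected_Int_frontier) (auto simp: disjoint_iff)
  then obtain y where "y \<in> frontier \<Omega>" "dist z y < r"
    by auto
  then show False
    using infdist_le[of y "frontier \<Omega>" z] assms(2) by (simp add: bdist_def)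
qed

lemma bdist_pos:
  assumes "open \<Omega>" "bounded \<Omega>" "x \<in> \<Omega>"
  shows "0 < bdist \<Omega> x"
proof -
  have "frontier \<Omega> \<noteq> {}"
    using assms by (intro frontier_bounded_not_empty) auto
  moreover have "x \<notin> frontier \<Omega>"
    using assms by (simp add: frontier_def interior_open)
  ultimately show ?thesis
    unfolding bdist_def by (simp add: infdist_pos_not_in_closed)
qed

lemma bdist_triangle: "bdist \<Omega> x \<le> bdist \<Omega> y + dist x y"
  unfolding bdist_def by (rule infdist_triangle)

text \<open>A ray from \<open>x\<close> pointing away from a frontier point \<open>w\<close> must
  leave the bounded set and so meets the frontier a second time. Positivity leaves room for radii
  below the diameter in the Assouad condition.\<close>

lemma diameter_frontier_pos:
  fixes \<Omega> :: "'a::euclidean_space set"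
  assumes "open \<Omega>" "bounded \<Omega>" "\<Omega> \<noteq> {}"
  shows "0 < diameter (frontier \<Omega>)"
proof -
  obtain x where x: "x \<in> \<Omega>"
    using assms by auto
  have x_front: "x \<notin> frontier \<Omega>"
    using assms x by (simp add: frontier_def interior_open)
  have "frontier \<Omega> \<noteq> {}"
    using assms by (intro frontier_bounded_not_empty) auto
  then obtain w where w: "w \<in> frontier \<Omega>"
    by auto
  define ray where "ray = (\<lambda>t. x + t *\<^sub>R (x - w)) ` {0..}"
  have "ray \<inter> frontier \<Omega> \<noteq> {}"
  proof (rule connected_Int_frontier)
    show "connected ray"
      unfolding ray_def by (intro connected_continuous_image continuous_intros) simp
    have "x \<in> ray"
      unfolding ray_def by (rule image_eqI[of _ _ 0]) auto
    then show "ray \<inter> \<Omega> \<noteq> {}"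
      using x by auto
    obtain B where B: "\<And>y. y \<in> \<Omega> \<Longrightarrow> norm y \<le> B"
      using \<open>bounded \<Omega>\<close> by (auto simp: bounded_iff)
    \<comment> \<open>A displacement of this length from \<open>x\<close> ends at norm at least
      \<open>\<bar>B\<bar> + 1\<close>, hence outside \<open>\<Omega>\<close>.\<close>
    define t where "t = (norm x + \<bar>B\<bar> + 1) / norm (x - w)"
    have "x \<noteq> w"
      using x_front w by auto
    then have t: "0 \<le> t" "norm (t *\<^sub>R (x - w)) = norm x + \<bar>B\<bar> + 1"
      by (auto simp: t_def)
    have "norm (t *\<^sub>R (x - w)) \<le> norm (x + t *\<^sub>R (x - w)) + norm x"
      by (metis add_diff_cancel_left' norm_triangle_ineq4)
    then have "x + t *\<^sub>R (x - w) \<notin> \<Omega>"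
      using B t(2) by fastforce
    then show "ray - \<Omega> \<noteq> {}"
      using t(1) by (auto simp: ray_def)
  qed
  then obtain t where t: "0 \<le> t" "x + t *\<^sub>R (x - w) \<in> frontier \<Omega>"
    by (auto simp: ray_def)
  have "x + t *\<^sub>R (x - w) \<noteq> w"
  proof
    assume "x + t *\<^sub>R (x - w) = w"
    then have "(1 + t) *\<^sub>R (x - w) = 0"
      by (simp add: algebra_simps)
    then show False
      using t(1) x_front w by auto
  qed
  then have "0 < dist (x + t *\<^sub>R (x - w)) w"
    by simp
  also have "\<dots> \<le> diameter (frontier \<Omega>)"
    using assms(2) t(2) w by (intro diameter_bounded_bound) (auto simp: frontier_def)
  finally show ?thesis .
qed

section \<open>Consequences of uniformity and of the codimension bound\<close>

text \<open>Along the curve from \<open>x\<close> to \<open>x0\<close> the distance to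
  \<open>x\<close> takes every value up to \<open>dist x x0\<close>. As \<open>r\<close> is at most
  half of that, a point at distance \<open>r\<close> from \<open>x\<close> is no nearer to
  \<open>x0\<close>, and the minimum in the uniformity condition equals \<open>r\<close>.\<close>

lemma uniform_domain_corkscrew:
  fixes \<Omega> :: "'a::euclidean_space set"
  assumes "uniform_domain \<Omega>" "x0 \<in> \<Omega>"
  obtains C where "1 \<le> C"
    and "\<And>x r. x \<in> \<Omega> \<Longrightarrow> 0 \<le> r \<Longrightarrow> 2 * r \<le> dist x x0 \<Longrightarrow> \<exists>z\<in>\<Omega>. dist x z = r \<and> r / C \<le> bdist \<Omega> z"
proof -
  obtain C where "1 \<le> C" and C: "\<forall>x\<in>\<Omega>. \<forall>y\<in>\<Omega>. \<exists>l \<gamma>.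
        arc_length_param \<gamma> l \<and> \<gamma> ` {0..l} \<subseteq> \<Omega> \<and> \<gamma> 0 = x \<and> \<gamma> l = y \<and>
        l \<le> C * norm (x - y) \<and>
        (\<forall>z\<in>\<gamma> ` {0..l}. bdist \<Omega> z \<ge> 1 / C * min (norm (z - x)) (norm (z - y)))"
    using assms(1) unfolding uniform_domain_def by blast
  show thesis
  proof (rule that[OF \<open>1 \<le> C\<close>])
    fix x r
    assume x: "x \<in> \<Omega>" and r: "0 \<le> r" "2 * r \<le> dist x x0"
    obtain l \<gamma> where \<gamma>: "arc_length_param \<gamma> l" "\<gamma> ` {0..l} \<subseteq> \<Omega>" "\<gamma> 0 = x" "\<gamma> l = x0"
      "\<And>z. z \<in> \<gamma> ` {0..l} \<Longrightarrow> bdist \<Omega> z \<ge> 1 / C * min (norm (z - x)) (norm (z - x0))"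
      using C x assms(2) by metis
    have "0 \<le> l" "continuous_on {0..l} \<gamma>"
      using \<gamma>(1) by (auto simp: arc_length_param_def)
    then have "\<exists>t. 0 \<le> t \<and> t \<le> l \<and> dist x (\<gamma> t) = r"
      using r \<gamma>(3,4) by (intro IVT') (auto intro!: continuous_intros)
    then obtain t where t: "t \<in> {0..l}" "dist x (\<gamma> t) = r"
      by auto
    have "r \<le> norm (\<gamma> t - x0)"
      using dist_triangle[of x x0 "\<gamma> t"] r t(2) by (simp add: dist_norm)
    then have "r / C \<le> 1 / C * min (norm (\<gamma> t - x)) (norm (\<gamma> t - x0))"
      using t(2) \<open>1 \<le> C\<close> by (simp add: dist_norm norm_minus_commute)
    also have "\<dots> \<le> bdist \<Omega> (\<gamma> t)"
      using \<gamma>(5) t(1) by blast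
    finally show "\<exists>z\<in>\<Omega>. dist x z = r \<and> r / C \<le> bdist \<Omega> z"
      using t \<gamma>(2) by blast
  qed
qed

text \<open>Lying strictly below a supremum provides an admissible exponent strictly above
  \<open>\<theta>\<close>; this gap later yields the negative exponent \<open>\<theta> - q\<close>
  on \<open>M\<close>.\<close>

lemma lower_assouad_codimE:
  fixes E :: "'a::euclidean_space set"
  assumes "ereal \<theta> < lower_assouad_codim E"
  obtains q C where "\<theta> < q" "1 \<le> C"
    and "\<And>x r R. x \<in> E \<Longrightarrow> 0 < r \<Longrightarrow> r < R \<Longrightarrow> R < diameter E \<Longrightarrow>
      measure lebesgue (tube E r \<inter> ball x R) \<le> C * measure lebesgue (ball x R) * (r / R) powr q"
  using assms unfolding lower_assouad_codim_def less_SUP_iff by auto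

section \<open>The averaging kernel and its estimates\<close>

lemma lebesgue_ball:
  fixes z :: "'a::euclidean_space"
  assumes "0 \<le> r"
  shows "measure lebesgue (ball z r) = unit_ball_vol (real DIM('a)) * r ^ DIM('a)"
  using content_ball[OF assms, of z] by (simp add: measure_completion)

text \<open>The denominator times \<open>d(x)\<close> to the dimension is the volume of the corkscrew ball of radius
  \<open>M d(x) / (2 C)\<close>; restricting \<open>y\<close> by distance and depth, instead of to such a ball,
  avoids a measurable choice of its centre.\<close>

definition hardy_kernel ::
  "'a::euclidean_space set \<Rightarrow> real \<Rightarrow> real \<Rightarrow> real \<Rightarrow> real \<Rightarrow> 'a \<Rightarrow> 'a \<Rightarrow> ennreal" where
  "hardy_kernel \<Omega> C M \<delta> \<theta> x y =
     (if bdist \<Omega> x < \<delta> \<and> dist x y \<le> 2 * M * bdist \<Omega> x \<and> M / (2 * C) * bdist \<Omega> x \<le> bdist \<Omega> y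
      then ennreal (bdist \<Omega> x powr (- \<theta> - real DIM('a))
             / (unit_ball_vol (real DIM('a)) * (M / (2 * C)) ^ DIM('a)))
      else 0)"

lemma borel_measurable_bdist[measurable]: "bdist \<Omega> \<in> borel_measurable borel"
  unfolding bdist_def by (intro borel_measurable_continuous_onI continuous_intros)

lemma borel_measurable_bdist_lebesgue_on[measurable]:
  "bdist \<Omega> \<in> borel_measurable (lebesgue_on S)"
  by (intro measurable_restrict_space1 measurable_completion) simp

lemma borel_measurable_hardy_kernel[measurable]:
  "case_prod (hardy_kernel \<Omega> C M \<delta> \<theta>) \<in> borel_measurable (lebesgue_on S \<Otimes>\<^sub>M lebesgue_on S)"
proof -
  have [measurable]: "(\<lambda>x. x) \<in> lebesgue_on S \<rightarrow>\<^sub>M borel"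
    using id_borel_measurable_lebesgue_on[of S] by (simp add: id_def)
  show ?thesis
    unfolding hardy_kernel_def by measurable
qed

text \<open>The support in \<open>y\<close> contains a ball about a corkscrew point, and the kernel
  is normalised by the volume of that ball. The condition on \<open>\<delta>\<close> keeps
  \<open>x\<close> far enough from \<open>x0\<close> for this corkscrew point to exist.\<close>

lemma hardy_kernel_lower:
  fixes \<Omega> :: "'a::euclidean_space set"
  assumes "open \<Omega>" "bounded \<Omega>" "x0 \<in> \<Omega>" "1 \<le> C" "1 \<le> M"
    and corkscrew: "\<And>x r. x \<in> \<Omega> \<Longrightarrow> 0 \<le> r \<Longrightarrow> 2 * r \<le> dist x x0 \<Longrightarrow>
      \<exists>z\<in>\<Omega>. dist x z = r \<and> r / C \<le> bdist \<Omega> z"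
    and \<delta>: "(2 * M + 1) * \<delta> \<le> bdist \<Omega> x0"
    and x: "x \<in> \<Omega>" "bdist \<Omega> x < \<delta>"
  shows "ennreal (bdist \<Omega> x powr (- \<theta>)) \<le> (\<integral>\<^sup>+y. hardy_kernel \<Omega> C M \<delta> \<theta> x y \<partial>lebesgue_on \<Omega>)"
proof -
  define h where "h = bdist \<Omega> x"
  have h: "0 < h" "h < \<delta>"
    using x bdist_pos assms by (auto simp: h_def)
  have "(2 * M + 1) * h \<le> (2 * M + 1) * \<delta>"
    using h \<open>1 \<le> M\<close> by (intro mult_left_mono) auto
  then have "2 * (M * h) \<le> dist x x0"
    using bdist_triangle[of \<Omega> x0 x] \<delta> by (simp add: h_def dist_commute algebra_simps)
  then obtain z where z: "z \<in> \<Omega>" "dist x z = M * h" "M * h / C \<le> bdist \<Omega> z"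
    using corkscrew[OF x(1), of "M * h"] h \<open>1 \<le> M\<close> by auto
  \<comment> \<open>At most half of the depth of \<open>z\<close>: points of \<open>ball z r\<close>
    still have depth at least \<open>r\<close>, which is the threshold in the kernel.\<close>
  define r where "r = M / (2 * C) * h"
  have r: "0 < r" "2 * r \<le> bdist \<Omega> z" "r \<le> M * h"
    using h z(3) \<open>1 \<le> M\<close> \<open>1 \<le> C\<close> by (auto simp: r_def field_simps)
  define v where "v = unit_ball_vol (real DIM('a)) * (M / (2 * C)) ^ DIM('a)"
  have v: "0 < v"
    using \<open>1 \<le> M\<close> \<open>1 \<le> C\<close> by (simp add: v_def)
  have sub: "ball z r \<subseteq> \<Omega>"
    using r z(1) by (intro ball_bdist_subset) auto
  have val: "hardy_kernel \<Omega> C M \<delta> \<theta> x y = ennreal (h powr (- \<theta> - real DIM('a)) / v)"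
    if "y \<in> ball z r" for y
  proof -
    have "dist x y \<le> 2 * M * h"
      using dist_triangle[of x y z] that z(2) r(3) by auto
    moreover have "r \<le> bdist \<Omega> y"
      using bdist_triangle[of \<Omega> z y] that r(2) by auto
    ultimately show ?thesis
      using h unfolding hardy_kernel_def v_def h_def[symmetric] r_def by auto
  qed
  have "h powr (- \<theta>) = h powr (- \<theta> - real DIM('a)) / v * measure lebesgue (ball z r)"
  proof -
    have "measure lebesgue (ball z r) = v * h ^ DIM('a)"
      by (subst lebesgue_ball) (use r in \<open>auto simp: v_def r_def power_mult_distrib power_divide\<close>)
    moreover have "h powr (- \<theta>) = h powr (- \<theta> - real DIM('a)) * h ^ DIM('a)"
      using h by (simp add: powr_realpow[symmetric] powr_add[symmetric])
    ultimately show ?thesis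
      using v by simp
  qed
  then have "ennreal (h powr (- \<theta>)) =
      ennreal (h powr (- \<theta> - real DIM('a)) / v) * emeasure lebesgue (ball z r)"
    using v by (simp add: emeasure_eq_measure2 ennreal_mult'[symmetric] fmeasurableD2)
  also have "emeasure lebesgue (ball z r) = emeasure (lebesgue_on \<Omega>) (ball z r)"
    using sub \<open>open \<Omega>\<close> by (intro emeasure_restrict_space[symmetric]) auto
  also have "ennreal (h powr (- \<theta> - real DIM('a)) / v) * \<dots> =
      (\<integral>\<^sup>+y. ennreal (h powr (- \<theta> - real DIM('a)) / v) * indicator (ball z r) y \<partial>lebesgue_on \<Omega>)"
    using sub \<open>open \<Omega>\<close> by (intro nn_integral_cmult_indicator[symmetric])
      (auto simp: sets_restrict_space_iff)
  also have "\<dots> \<le> (\<integral>\<^sup>+y. hardy_kernel \<Omega> C M \<delta> \<theta> x y \<partial>lebesgue_on \<Omega>)"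
    using val by (intro nn_integral_mono) (auto simp: indicator_def)
  finally show ?thesis
    by (simp add: h_def)
qed

text \<open>The distance to the frontier is 1-Lipschitz. With the depth condition of the kernel this
  confines d(x) between d(y) / (3 \<open>M\<close>) and 2 \<open>C\<close> d(y) /
  \<open>M\<close>.\<close>

lemma hardy_kernel_bdist_le:
  assumes "hardy_kernel \<Omega> C M \<delta> \<theta> x y \<noteq> 0" "1 \<le> M"
  shows "bdist \<Omega> y \<le> 3 * M * bdist \<Omega> x"
proof -
  have "dist x y \<le> 2 * M * bdist \<Omega> x"
    using assms by (auto simp: hardy_kernel_def split: if_splits)
  moreover have "bdist \<Omega> x \<le> M * bdist \<Omega> x"
    using mult_right_mono[OF \<open>1 \<le> M\<close>, of "bdist \<Omega> x"] by (simp add: bdist_def infdist_nonneg)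
  ultimately show ?thesis
    using bdist_triangle[of \<Omega> y x] by (simp add: dist_commute)
qed

text \<open>What matters is that \<open>M\<close> enters the bound only through
  \<open>(3 * M) powr (\<theta> - q)\<close>: the powers of \<open>M\<close> whose exponent is the
  dimension cancel.\<close>

lemma hardy_kernel_upper:
  fixes \<Omega> :: "'a::euclidean_space set"
  assumes "open \<Omega>" "bounded \<Omega>" "1 \<le> C" "1 \<le> M" "0 \<le> \<theta>" "1 \<le> C'"
    and assouad: "\<And>x r R. x \<in> frontier \<Omega> \<Longrightarrow> 0 < r \<Longrightarrow> r < R \<Longrightarrow> R < diameter (frontier \<Omega>) \<Longrightarrow>
      measure lebesgue (tube (frontier \<Omega>) r \<inter> ball x R) \<le> C' * measure lebesgue (ball x R) * (r / R) powr q"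
    and \<delta>: "18 * C * M * \<delta> \<le> diameter (frontier \<Omega>)"
    and y: "y \<in> \<Omega>"
  shows "(\<integral>\<^sup>+x. hardy_kernel \<Omega> C M \<delta> \<theta> x y \<partial>lebesgue_on \<Omega>)
    \<le> ennreal (C' * (36 * C\<^sup>2) ^ DIM('a) * (3 * M) powr (\<theta> - q) * bdist \<Omega> y powr (- \<theta>))"
proof (cases "bdist \<Omega> y < 3 * M * \<delta>")
  \<comment> \<open>Such a deep \<open>y\<close> is linked to no \<open>x\<close>. The remaining
    ones have \<open>6 * C * bdist \<Omega> y < 18 * C * M * \<delta>\<close>, which puts the radius
    \<open>R\<close> below the diameter and explains the constant 18.\<close>
  case False
  have zero: "hardy_kernel \<Omega> C M \<delta> \<theta> x y = 0" for x
  proof (rule ccontr)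
    assume nz: "hardy_kernel \<Omega> C M \<delta> \<theta> x y \<noteq> 0"
    then have "bdist \<Omega> x < \<delta>"
      by (auto simp: hardy_kernel_def split: if_splits)
    then have "3 * M * bdist \<Omega> x < 3 * M * \<delta>"
      using \<open>1 \<le> M\<close> by (intro mult_strict_left_mono) auto
    with hardy_kernel_bdist_le[OF nz \<open>1 \<le> M\<close>] False show False
      by simp
  qed
  show ?thesis
    by (simp add: zero)
next
  case True
  define e where "e = bdist \<Omega> y"
  have e: "0 < e" "e < 3 * M * \<delta>"
    using True bdist_pos[OF \<open>open \<Omega>\<close> \<open>bounded \<Omega>\<close> y] by (auto simp: e_def)
  define n where "n = DIM('a)"
  define V where "V = unit_ball_vol (real n)"
  have V: "0 < V"
    by (simp add: V_def)
  \<comment> \<open>The depth condition bounds d(x) by \<open>\<rho>\<close>. From \<open>x\<close>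
    to \<open>y\<close> the distance is at most 2 \<open>M\<close> d(x), hence at most
    \<open>4 * C * e\<close>, and from \<open>y\<close> to its nearest frontier point
    \<open>w\<close> it is \<open>e\<close>; so \<open>R\<close> exceeds the distance from
    \<open>x\<close> to \<open>w\<close>.\<close>
  define \<rho> where "\<rho> = 2 * C * e / M"
  define R where "R = 6 * C * e"
  have "frontier \<Omega> \<noteq> {}"
    using \<open>bounded \<Omega>\<close> y by (intro frontier_bounded_not_empty) auto
  then obtain w where w: "w \<in> frontier \<Omega>" "infdist y (frontier \<Omega>) = dist y w"
    using infdist_attains_inf[OF frontier_closed] by metis
  then have w_dist: "dist y w = e"
    unfolding e_def bdist_def by simp
  have "0 < C * e"
    using e \<open>1 \<le> C\<close> by simp
  moreover from this have "2 * C * e / M \<le> 2 * C * e / 1"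
    using \<open>1 \<le> M\<close> by (intro divide_left_mono) auto
  ultimately have \<rho>: "0 < \<rho>" "\<rho> < R"
    using \<open>1 \<le> M\<close> by (auto simp: \<rho>_def R_def)
  have "R < 6 * C * (3 * M * \<delta>)"
    unfolding R_def using e \<open>1 \<le> C\<close> by (intro mult_strict_left_mono) auto
  then have R: "R < diameter (frontier \<Omega>)"
    using \<delta> by (simp add: ac_simps)
  define S where "S = tube (frontier \<Omega>) \<rho> \<inter> ball w R"
  \<comment> \<open>The kernel value at the least possible depth \<open>e / (3 * M)\<close> of
    \<open>x\<close>; as the exponent is negative, it bounds all the others.\<close>
  define b where "b = (e / (3 * M)) powr (- \<theta> - real n) / (V * (M / (2 * C)) ^ n)"
  have S_borel: "S \<in> sets borel"
    unfolding S_def tube_def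
    by (intro sets.Int borel_open[OF open_ball] borel_closed closed_Collect_le continuous_intros)
  have le: "hardy_kernel \<Omega> C M \<delta> \<theta> x y \<le> ennreal b * indicator S x" for x
  proof (cases "hardy_kernel \<Omega> C M \<delta> \<theta> x y = 0")
    case False
    define h where "h = bdist \<Omega> x"
    have K: "dist x y \<le> 2 * M * h" "M / (2 * C) * h \<le> e"
      using False by (auto simp: hardy_kernel_def e_def h_def split: if_splits)
    have eh: "e / (3 * M) \<le> h"
      using hardy_kernel_bdist_le[OF False \<open>1 \<le> M\<close>] \<open>1 \<le> M\<close>
      by (simp add: e_def h_def field_simps)
    have Mh: "M * h \<le> 2 * C * e"
      using K(2) \<open>1 \<le> C\<close> by (simp add: field_simps)
    have "h \<le> \<rho>"
      using Mh \<open>1 \<le> M\<close> by (simp add: \<rho>_def field_simps)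
    then have "x \<in> tube (frontier \<Omega>) \<rho>"
      by (simp add: tube_def h_def bdist_def)
    moreover have "dist w x < R"
    proof -
      have "dist w x \<le> dist x y + dist y w"
        using dist_triangle[of w x y] by (simp add: dist_commute)
      also have "\<dots> \<le> 4 * C * e + e"
        using K(1) Mh w_dist by simp
      also have "\<dots> < 4 * C * e + 2 * C * e"
        using e \<open>1 \<le> C\<close> by simp
      finally show ?thesis
        by (simp add: R_def)
    qed
    moreover have "h powr (- \<theta> - real n) \<le> (e / (3 * M)) powr (- \<theta> - real n)"
      using eh e \<open>1 \<le> M\<close> \<open>0 \<le> \<theta>\<close> by (intro powr_mono2') auto
    then have "hardy_kernel \<Omega> C M \<delta> \<theta> x y \<le> ennreal b"
      unfolding hardy_kernel_def b_def h_def[symmetric] n_def[symmetric] V_def[symmetric]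
      using V \<open>1 \<le> M\<close> \<open>1 \<le> C\<close> by (auto intro!: ennreal_leI divide_right_mono)
    ultimately show ?thesis
      by (simp add: S_def)
  qed simp
  \<comment> \<open>The Assouad condition measures a set that may reach outside
    \<open>\<Omega>\<close>, so the integral is first extended to the whole space.\<close>
  have "(\<integral>\<^sup>+x. hardy_kernel \<Omega> C M \<delta> \<theta> x y \<partial>lebesgue_on \<Omega>)
      \<le> (\<integral>\<^sup>+x. hardy_kernel \<Omega> C M \<delta> \<theta> x y \<partial>lebesgue)"
    using \<open>open \<Omega>\<close> by (subst nn_integral_restrict_space)
      (auto intro!: nn_integral_mono simp: indicator_def)
  also have "\<dots> \<le> (\<integral>\<^sup>+x. ennreal b * indicator S x \<partial>lebesgue)"
    by (intro nn_integral_mono le)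
  also have "\<dots> = ennreal b * emeasure lebesgue S"
    using S_borel by (intro nn_integral_cmult_indicator) auto
  also have "\<dots> = ennreal (b * measure lebesgue S)"
  proof -
    have "S \<in> lmeasurable"
      using S_borel by (intro bounded_set_imp_lmeasurable bounded_subset[OF bounded_ball[of w R]])
        (auto simp: S_def)
    then show ?thesis
      using V \<open>1 \<le> M\<close> \<open>1 \<le> C\<close>
      by (subst ennreal_mult) (auto simp: emeasure_eq_measure2 b_def)
  qed
  also have "b * measure lebesgue S \<le> b * (C' * measure lebesgue (ball w R) * (\<rho> / R) powr q)"
    unfolding S_def using w(1) \<rho> R V \<open>1 \<le> M\<close> \<open>1 \<le> C\<close>
    by (intro mult_left_mono assouad) (auto simp: b_def)
  \<comment> \<open>The radius \<open>6 * C * e\<close>, the factor \<open>3 * M / e\<close> from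
    \<open>b\<close> and the normalisation \<open>2 * C / M\<close> multiply to
    \<open>36 * C\<^sup>2\<close>, free of \<open>M\<close> and \<open>e\<close>; the tube
    contributes \<open>(3 * M) powr (- q)\<close>.\<close>
  also have "\<dots> = C' * (36 * C\<^sup>2) ^ n * (3 * M) powr (\<theta> - q) * e powr (- \<theta>)"
  proof -
    have m: "measure lebesgue (ball w R) = V * (6 * C * e) ^ n"
      by (subst lebesgue_ball) (use \<rho> in \<open>auto simp: R_def V_def n_def\<close>)
    have rr: "(\<rho> / R) powr q = (3 * M) powr (- q)"
    proof -
      have "\<rho> / R = 1 / (3 * M)"
        using e \<open>1 \<le> M\<close> \<open>1 \<le> C\<close> by (simp add: \<rho>_def R_def field_simps)
      then show ?thesis
        using \<open>1 \<le> M\<close> by (simp add: powr_divide powr_minus_divide)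
    qed
    have b': "b = e powr (- \<theta>) / e ^ n * ((3 * M) powr \<theta> * (3 * M) ^ n) / (V * (M / (2 * C)) ^ n)"
    proof -
      have "(e / (3 * M)) powr (- \<theta> - real n) =
          e powr (- \<theta>) / e ^ n / ((3 * M) powr (- \<theta>) / (3 * M) ^ n)"
        using e \<open>1 \<le> M\<close> by (simp only: powr_diff powr_divide) (simp add: powr_realpow)
      also have "\<dots> = e powr (- \<theta>) / e ^ n * ((3 * M) powr \<theta> * (3 * M) ^ n)"
        by (simp only: powr_minus_divide) simp
      finally show ?thesis
        by (simp only: b_def)
    qed
    have t: "(3 * M) powr (\<theta> - q) = (3 * M) powr \<theta> * (3 * M) powr (- q)"
      by (simp add: powr_add[symmetric])
    have p: "(6 * C * e) ^ n * (3 * M) ^ n = (36 * C\<^sup>2) ^ n * e ^ n * (M / (2 * C)) ^ n"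
    proof -
      have "6 * C * e * (3 * M) = 36 * C\<^sup>2 * e * (M / (2 * C))"
        using \<open>1 \<le> C\<close> by (simp add: power2_eq_square)
      then show ?thesis
        by (simp only: power_mult_distrib[symmetric])
    qed
    have "b * (C' * measure lebesgue (ball w R) * (\<rho> / R) powr q) =
       e powr (- \<theta>) * ((3 * M) powr \<theta> * (3 * M) powr (- q)) * C' *
       ((6 * C * e) ^ n * (3 * M) ^ n / (e ^ n * (M / (2 * C)) ^ n))"
      unfolding b' m rr using V e \<open>1 \<le> M\<close> \<open>1 \<le> C\<close> by simp
    also have "(6 * C * e) ^ n * (3 * M) ^ n / (e ^ n * (M / (2 * C)) ^ n) = (36 * C\<^sup>2) ^ n"
      unfolding p using e \<open>1 \<le> M\<close> \<open>1 \<le> C\<close> by simp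
    finally show ?thesis
      unfolding t by (simp add: ac_simps)
  qed
  finally show ?thesis
    by (simp add: e_def n_def ennreal_leI)
qed

text \<open>The power of d(x) in the kernel splits into three factors. The one with exponent
  \<open>- (real DIM('a) + s * p)\<close> is traded for a power of \<open>norm (x - y)\<close>, the
  one with \<open>- \<alpha>\<close> for a power of d(y), and the one with \<open>- \<beta>\<close>
  is kept.\<close>

lemma hardy_kernel_le_W_integrand:
  fixes \<Omega> :: "'a::euclidean_space set" and s p \<alpha> \<beta> a :: real
  assumes "open \<Omega>" "bounded \<Omega>" "1 \<le> C" "1 \<le> M" "0 \<le> s * p" "0 \<le> \<alpha>" "x \<in> \<Omega>" "y \<in> \<Omega>" "x \<noteq> y"
  shows "hardy_kernel \<Omega> C M \<delta> (s * p + \<alpha> + \<beta>) x y * ennreal (a powr p)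
    \<le> ennreal ((2 * M) powr (real DIM('a) + s * p) * (3 * M) powr \<alpha>
          / (unit_ball_vol (real DIM('a)) * (M / (2 * C)) ^ DIM('a)))
      * ennreal (a powr p / norm (x - y) powr (real DIM('a) + s * p)
           * bdist \<Omega> y powr (- \<alpha>) * bdist \<Omega> x powr (- \<beta>))"
proof (cases "hardy_kernel \<Omega> C M \<delta> (s * p + \<alpha> + \<beta>) x y = 0")
  case False
  define h e t N v where "h = bdist \<Omega> x" and "e = bdist \<Omega> y" and "t = norm (x - y)"
    and "N = real DIM('a) + s * p"
    and "v = unit_ball_vol (real DIM('a)) * (M / (2 * C)) ^ DIM('a)"
  have pos: "0 < h" "0 < e" "0 < t" "0 < v" "0 \<le> N"
    using assms bdist_pos by (auto simp: h_def e_def t_def v_def N_def)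
  have "t \<le> 2 * M * h"
    using False by (auto simp: hardy_kernel_def t_def h_def dist_norm split: if_splits)
  then have "t / (2 * M) \<le> h"
    using \<open>1 \<le> M\<close> by (simp add: field_simps)
  then have "h powr (- N) \<le> (t / (2 * M)) powr (- N)"
    using pos \<open>1 \<le> M\<close> by (intro powr_mono2') auto
  also have "\<dots> = (2 * M) powr N / t powr N"
    using pos \<open>1 \<le> M\<close> by (simp add: powr_divide powr_minus divide_simps)
  finally have 1: "h powr (- N) \<le> (2 * M) powr N / t powr N" .
  have "e / (3 * M) \<le> h"
    using hardy_kernel_bdist_le[OF False \<open>1 \<le> M\<close>] \<open>1 \<le> M\<close>
    by (simp add: e_def h_def field_simps)
  then have "h powr (- \<alpha>) \<le> (e / (3 * M)) powr (- \<alpha>)"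
    using pos \<open>1 \<le> M\<close> \<open>0 \<le> \<alpha>\<close> by (intro powr_mono2') auto
  also have "\<dots> = (3 * M) powr \<alpha> * e powr (- \<alpha>)"
    using pos \<open>1 \<le> M\<close> by (simp add: powr_divide powr_minus divide_simps)
  finally have 2: "h powr (- \<alpha>) \<le> (3 * M) powr \<alpha> * e powr (- \<alpha>)" .
  have "h powr (- (s * p + \<alpha> + \<beta>) - real DIM('a)) = h powr (- N) * h powr (- \<alpha>) * h powr (- \<beta>)"
    by (simp add: N_def powr_add[symmetric] algebra_simps)
  also have "\<dots> \<le> ((2 * M) powr N / t powr N) * ((3 * M) powr \<alpha> * e powr (- \<alpha>)) * h powr (- \<beta>)"
    using 1 2 by (intro mult_right_mono mult_mono) auto
  finally have "h powr (- (s * p + \<alpha> + \<beta>) - real DIM('a)) / v * a powr p \<le>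
      ((2 * M) powr N / t powr N) * ((3 * M) powr \<alpha> * e powr (- \<alpha>)) * h powr (- \<beta>) / v * a powr p"
    using pos by (intro mult_right_mono divide_right_mono) auto
  also have "\<dots> = (2 * M) powr N * (3 * M) powr \<alpha> / v *
      (a powr p / t powr N * e powr (- \<alpha>) * h powr (- \<beta>))"
    by (simp add: ac_simps)
  finally have "ennreal (h powr (- (s * p + \<alpha> + \<beta>) - real DIM('a)) / v * a powr p) \<le>
      ennreal ((2 * M) powr N * (3 * M) powr \<alpha> / v *
      (a powr p / t powr N * e powr (- \<alpha>) * h powr (- \<beta>)))"
    by (rule ennreal_leI)
  moreover have "hardy_kernel \<Omega> C M \<delta> (s * p + \<alpha> + \<beta>) x y =
      ennreal (h powr (- (s * p + \<alpha> + \<beta>) - real DIM('a)) / v)"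
    using False by (auto simp: hardy_kernel_def h_def v_def split: if_splits)
  ultimately show ?thesis
    using pos by (simp add: ennreal_mult'[symmetric] ennreal_mult''[symmetric] h_def e_def t_def N_def v_def)
qed simp

section \<open>Choice of the constants and assembly of the inequality\<close>

lemma epowr_mono: "0 \<le> a \<Longrightarrow> x \<le> y \<Longrightarrow> epowr x a \<le> epowr y a"
  by (auto simp: epowr_def top_unique less_top intro!: ennreal_leI powr_mono2 enn2real_mono)

lemma epowr_epowr_inverse: "0 < p \<Longrightarrow> epowr (epowr x (1 / p)) p = x"
  by (auto simp: epowr_def powr_powr less_top)

lemma epowr_less_top: "x < \<infinity> \<Longrightarrow> epowr x a < \<infinity>"
  by (auto simp: epowr_def)

lemma exists_ge_mult_powr_le_one:
  fixes a b c0 :: real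
  assumes "a < 0"
  shows "\<exists>M\<ge>c0. b * (3 * M) powr a \<le> 1"
proof -
  have "((\<lambda>M. b * (3 * M) powr a) \<longlongrightarrow> b * 0) at_top"
    using assms by (intro tendsto_intros tendsto_neg_powr filterlim_tendsto_pos_mult_at_top[OF tendsto_const])
      (auto simp: filterlim_ident)
  then have "eventually (\<lambda>M. b * (3 * M) powr a < 1) at_top"
    by (rule order_tendstoD) simp
  then have "eventually (\<lambda>M. c0 \<le> M \<and> b * (3 * M) powr a < 1) at_top"
    using eventually_ge_at_top[of c0] by eventually_elim simp
  then show ?thesis
    by (metis (no_types, lifting) eventually_at_top_linorder less_imp_le order_refl)
qed

theorem theorem7:
  fixes \<Omega> :: "'a::euclidean_space set" and s p \<alpha> \<beta> :: real
  assumes "1 \<le> p" and "0 < s" and "s < 1"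
    and "\<Omega> \<noteq> {}" and "open \<Omega>" and "uniform_domain \<Omega>" and "bounded \<Omega>"
    and "0 \<le> \<alpha>" and "ereal \<alpha> < lower_assouad_codim (frontier \<Omega>)"
    and "0 \<le> \<beta>" and "ereal \<beta> < lower_assouad_codim (frontier \<Omega>)"
    and "ereal (s * p + \<alpha> + \<beta>) < lower_assouad_codim (frontier \<Omega>)"
  shows "\<exists>c::real. 0 \<le> c \<and> (\<forall>f \<in> W_space \<Omega> s p \<alpha> \<beta>.
           (\<integral>\<^sup>+x. ennreal (\<bar>f x\<bar> powr p / bdist \<Omega> x powr (s * p + \<alpha> + \<beta>)) \<partial>lebesgue_on \<Omega>)
             \<le> ennreal c * epowr (W_norm \<Omega> s p \<alpha> \<beta> f) p
         \<and> ennreal c * epowr (W_norm \<Omega> s p \<alpha> \<beta> f) p < \<infinity>)"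
proof -
  define \<theta> where "\<theta> = s * p + \<alpha> + \<beta>"
  have sp: "0 \<le> s * p"
    using assms by simp
  then have \<theta>: "0 \<le> \<theta>"
    using assms by (simp add: \<theta>_def)
  obtain x0 where x0: "x0 \<in> \<Omega>"
    using assms by auto
  obtain C where C: "1 \<le> C"
    and corkscrew: "\<And>x r. x \<in> \<Omega> \<Longrightarrow> 0 \<le> r \<Longrightarrow> 2 * r \<le> dist x x0 \<Longrightarrow>
      \<exists>z\<in>\<Omega>. dist x z = r \<and> r / C \<le> bdist \<Omega> z"
    using uniform_domain_corkscrew[OF \<open>uniform_domain \<Omega>\<close> x0] by blast
  obtain q C' where q: "\<theta> < q" and C': "1 \<le> C'"
    and assouad: "\<And>x r R. x \<in> frontier \<Omega> \<Longrightarrow> 0 < r \<Longrightarrow> r < R \<Longrightarrow> R < diameter (frontier \<Omega>) \<Longrightarrow>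
      measure lebesgue (tube (frontier \<Omega>) r \<inter> ball x R) \<le> C' * measure lebesgue (ball x R) * (r / R) powr q"
    using lower_assouad_codimE[of \<theta> "frontier \<Omega>"] assms(12) unfolding \<theta>_def by blast
  define B where "B = C' * (36 * C\<^sup>2) ^ DIM('a)"
  have B: "0 \<le> B"
    using C' by (simp add: B_def)
  \<comment> \<open>The first condition makes the kernel link \<open>x\<close> only to points at
    least as deep; the second is the smallness that absorption requires.\<close>
  obtain M where M: "2 * C \<le> M" "(2 * 2 powr p * B) * (3 * M) powr (\<theta> - q) \<le> 1"
    using exists_ge_mult_powr_le_one[of "\<theta> - q" "2 * C" "2 * 2 powr p * B"] q by auto
  have M1: "1 \<le> M"
    using M C by simp
  \<comment> \<open>The first entry serves the lower bound of the kernel integral, the second the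
    upper bound.\<close>
  define \<delta> where "\<delta> = min (bdist \<Omega> x0 / (2 * M + 1)) (diameter (frontier \<Omega>) / (18 * C * M))"
  have \<delta>: "0 < \<delta>" "(2 * M + 1) * \<delta> \<le> bdist \<Omega> x0" "18 * C * M * \<delta> \<le> diameter (frontier \<Omega>)"
  proof -
    show "0 < \<delta>"
      using bdist_pos[of \<Omega> x0] diameter_frontier_pos[of \<Omega>] assms x0 C M1 by (simp add: \<delta>_def)
    have "\<delta> \<le> bdist \<Omega> x0 / (2 * M + 1)" "\<delta> \<le> diameter (frontier \<Omega>) / (18 * C * M)"
      by (auto simp: \<delta>_def)
    then show "(2 * M + 1) * \<delta> \<le> bdist \<Omega> x0" "18 * C * M * \<delta> \<le> diameter (frontier \<Omega>)"
      using C M1 by (auto simp: pos_le_divide_eq mult.commute)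
  qed
  define K where "K = hardy_kernel \<Omega> C M \<delta> \<theta>"
  define L where "L = (2 * M) powr (real DIM('a) + s * p) * (3 * M) powr \<alpha>
          / (unit_ball_vol (real DIM('a)) * (M / (2 * C)) ^ DIM('a))"
  have L: "0 \<le> L"
    using M1 C by (simp add: L_def)
  define u where "u = (\<lambda>x. ennreal (bdist \<Omega> x powr (- \<theta>)))"
  \<comment> \<open>The outer 2 comes from absorption, \<open>2 powr p * L\<close> from the
    differences, and \<open>\<delta> powr (- \<theta>)\<close> from the points of depth at least
    \<open>\<delta>\<close>.\<close>
  define c where "c = 2 * (2 powr p * L + \<delta> powr (- \<theta>))"
  have c: "0 \<le> c"
    using L by (simp add: c_def)
  have "finite_measure (lebesgue_on \<Omega>)"
    using assms by (intro finite_measure_lebesgue_on bounded_set_imp_lmeasurable) auto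
  then have sf: "sigma_finite_measure (lebesgue_on \<Omega>)"
    by (rule finite_measure.axioms)
  have main: "(\<integral>\<^sup>+x. ennreal (\<bar>f x\<bar> powr p / bdist \<Omega> x powr \<theta>) \<partial>lebesgue_on \<Omega>)
             \<le> ennreal c * epowr (W_norm \<Omega> s p \<alpha> \<beta> f) p
         \<and> ennreal c * epowr (W_norm \<Omega> s p \<alpha> \<beta> f) p < \<infinity>"
    if f: "f \<in> W_space \<Omega> s p \<alpha> \<beta>" for f
  proof
    have fm[measurable]: "f \<in> borel_measurable (lebesgue_on \<Omega>)"
      and fin: "Lp_norm \<Omega> p f < \<infinity>" "W_seminorm \<Omega> s p \<alpha> \<beta> f < \<infinity>"
      using f by (auto simp: W_space_def Lp_space_def)
    define W where "W = epowr (W_norm \<Omega> s p \<alpha> \<beta> f) p"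
    have W: "W < \<infinity>"
      unfolding W_def using fin by (intro epowr_less_top) (simp add: W_norm_def)
    then show "ennreal c * epowr (W_norm \<Omega> s p \<alpha> \<beta> f) p < \<infinity>"
      by (simp add: W_def ennreal_mult_less_top)
    define D where "D = (\<integral>\<^sup>+x. (\<integral>\<^sup>+y.
         ennreal (\<bar>f x - f y\<bar> powr p / norm (x - y) powr (real DIM('a) + s * p)
           * bdist \<Omega> y powr (- \<alpha>) * bdist \<Omega> x powr (- \<beta>))
       \<partial>lebesgue_on \<Omega>) \<partial>lebesgue_on \<Omega>)"
    define F where "F = (\<integral>\<^sup>+x. ennreal (\<bar>f x\<bar> powr p) \<partial>lebesgue_on \<Omega>)"
    have "epowr (W_seminorm \<Omega> s p \<alpha> \<beta> f) p \<le> W" "epowr (Lp_norm \<Omega> p f) p \<le> W"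
      unfolding W_def W_norm_def using assms(1) by (auto intro!: epowr_mono)
    then have DF: "D \<le> W" "F \<le> W"
      using assms(1) by (simp_all add: W_seminorm_def Lp_norm_def epowr_epowr_inverse D_def F_def)
    \<comment> \<open>Away from the boundary the weight is bounded. This serves twice: for every
      \<open>t\<close>, to make the absorbed integral finite, and for \<open>t = \<delta>\<close>,
      to bound the remaining term.\<close>
    have trunc: "(\<integral>\<^sup>+x. ennreal (\<bar>f x\<bar> powr p) * u x * indicator A x \<partial>lebesgue_on \<Omega>)
        \<le> ennreal (t powr (- \<theta>)) * F" if t: "0 < t" "\<And>x. x \<in> A \<Longrightarrow> t \<le> bdist \<Omega> x" for t A
    proof -
      have "(\<integral>\<^sup>+x. ennreal (\<bar>f x\<bar> powr p) * u x * indicator A x \<partial>lebesgue_on \<Omega>)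
        \<le> (\<integral>\<^sup>+x. ennreal (t powr (- \<theta>)) * ennreal (\<bar>f x\<bar> powr p) \<partial>lebesgue_on \<Omega>)"
      proof (rule nn_integral_mono)
        fix x
        have "u x \<le> ennreal (t powr (- \<theta>))" if "x \<in> A"
          unfolding u_def using t \<theta> that by (intro ennreal_leI powr_mono2') auto
        then show "ennreal (\<bar>f x\<bar> powr p) * u x * indicator A x
            \<le> ennreal (t powr (- \<theta>)) * ennreal (\<bar>f x\<bar> powr p)"
          by (auto simp: indicator_def mult.commute intro!: mult_right_mono)
      qed
      also have "\<dots> = ennreal (t powr (- \<theta>)) * F"
        unfolding F_def by (rule nn_integral_cmult) measurable
      finally show ?thesis .
    qed
    have "(\<integral>\<^sup>+x. ennreal (\<bar>f x\<bar> powr p / bdist \<Omega> x powr \<theta>) \<partial>lebesgue_on \<Omega>)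
        = (\<integral>\<^sup>+x. ennreal (\<bar>f x\<bar> powr p) * u x \<partial>lebesgue_on \<Omega>)"
      by (simp add: u_def ennreal_mult'[symmetric] powr_minus divide_inverse)
    also have "\<dots> \<le> 2 * (ennreal (2 powr p) * (\<integral>\<^sup>+x. \<integral>\<^sup>+y. K x y * ennreal (\<bar>f x - f y\<bar> powr p)
           \<partial>lebesgue_on \<Omega> \<partial>lebesgue_on \<Omega>)
         + (\<integral>\<^sup>+x. ennreal (\<bar>f x\<bar> powr p) * u x * indicator {x. \<delta> \<le> bdist \<Omega> x} x \<partial>lebesgue_on \<Omega>))"
    proof (rule weighted_Lp_absorption[OF sf fm, where w = "bdist \<Omega>"])
      show "u \<in> borel_measurable (lebesgue_on \<Omega>)"
        unfolding u_def by measurable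
      show "case_prod K \<in> borel_measurable (lebesgue_on \<Omega> \<Otimes>\<^sub>M lebesgue_on \<Omega>)"
        unfolding K_def by measurable
      show "u x \<le> (\<integral>\<^sup>+y. K x y \<partial>lebesgue_on \<Omega>)"
        if "x \<in> space (lebesgue_on \<Omega>)" "bdist \<Omega> x < \<delta>" for x
        unfolding u_def K_def using that assms x0 C M1 corkscrew \<delta>
        by (intro hardy_kernel_lower[of _ x0]) auto
      show "ennreal (2 * 2 powr p) * (\<integral>\<^sup>+x. K x y \<partial>lebesgue_on \<Omega>) \<le> u y"
        if "y \<in> space (lebesgue_on \<Omega>)" for y
      proof -
        have "(\<integral>\<^sup>+x. K x y \<partial>lebesgue_on \<Omega>)
            \<le> ennreal (B * (3 * M) powr (\<theta> - q) * bdist \<Omega> y powr (- \<theta>))"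
          unfolding K_def B_def using that assms(5,7) C M1 C' \<theta> assouad \<delta>
          by (intro hardy_kernel_upper) auto
        then have "ennreal (2 * 2 powr p) * (\<integral>\<^sup>+x. K x y \<partial>lebesgue_on \<Omega>)
            \<le> ennreal (2 * 2 powr p) * ennreal (B * (3 * M) powr (\<theta> - q) * bdist \<Omega> y powr (- \<theta>))"
          by (rule mult_left_mono) simp
        also have "\<dots> = ennreal ((2 * 2 powr p * B) * (3 * M) powr (\<theta> - q) * bdist \<Omega> y powr (- \<theta>))"
          by (simp add: ennreal_mult'[symmetric] ac_simps)
        also have "\<dots> \<le> u y"
          unfolding u_def using mult_right_mono[OF M(2), of "bdist \<Omega> y powr (- \<theta>)"]
          by (intro ennreal_leI) simp
        finally show ?thesis .
      qed
      show "bdist \<Omega> x \<le> bdist \<Omega> y" if "K x y \<noteq> 0" for x y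
      proof -
        have "M / (2 * C) * bdist \<Omega> x \<le> bdist \<Omega> y"
          using that by (auto simp: K_def hardy_kernel_def split: if_splits)
        moreover have "1 * bdist \<Omega> x \<le> M / (2 * C) * bdist \<Omega> x"
          using M(1) C by (intro mult_right_mono) (auto simp: bdist_def infdist_nonneg)
        ultimately show ?thesis
          by simp
      qed
      show "(\<integral>\<^sup>+x. ennreal (\<bar>f x\<bar> powr p) * u x * indicator {x. t < bdist \<Omega> x} x \<partial>lebesgue_on \<Omega>) < \<infinity>"
        if "0 < t" for t
      proof -
        have "ennreal (t powr (- \<theta>)) * F < \<infinity>"
          using le_less_trans[OF DF(2) W] by (simp add: ennreal_mult_less_top)
        then show ?thesis
          using trunc[of t "{x. t < bdist \<Omega> x}"] that by (force intro: le_less_trans)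
      qed
    qed (use assms bdist_pos in auto)
    also have "\<dots> \<le> 2 * (ennreal (2 powr p) * (ennreal L * W) + ennreal (\<delta> powr (- \<theta>)) * W)"
    proof (intro mult_left_mono add_mono)
      have "(\<integral>\<^sup>+x. \<integral>\<^sup>+y. K x y * ennreal (\<bar>f x - f y\<bar> powr p) \<partial>lebesgue_on \<Omega> \<partial>lebesgue_on \<Omega>)
          \<le> (\<integral>\<^sup>+x. (\<integral>\<^sup>+y. ennreal L *
         ennreal (\<bar>f x - f y\<bar> powr p / norm (x - y) powr (real DIM('a) + s * p)
           * bdist \<Omega> y powr (- \<alpha>) * bdist \<Omega> x powr (- \<beta>))
            \<partial>lebesgue_on \<Omega>) \<partial>lebesgue_on \<Omega>)"
      proof (intro nn_integral_mono)
        fix x y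
        assume "x \<in> space (lebesgue_on \<Omega>)" "y \<in> space (lebesgue_on \<Omega>)"
        then have "x \<in> \<Omega>" "y \<in> \<Omega>"
          by auto
        \<comment> \<open>On the diagonal both sides vanish, since
          \<open>0 powr p = 0\<close>.\<close>
        then show "K x y * ennreal (\<bar>f x - f y\<bar> powr p) \<le> ennreal L *
         ennreal (\<bar>f x - f y\<bar> powr p / norm (x - y) powr (real DIM('a) + s * p)
           * bdist \<Omega> y powr (- \<alpha>) * bdist \<Omega> x powr (- \<beta>))"
          unfolding K_def L_def \<theta>_def
          using hardy_kernel_le_W_integrand[OF assms(5,7) C M1 sp assms(8), of x y \<delta> \<beta> "\<bar>f x - f y\<bar>"]
          by (cases "x = y") auto
      qed
      also have "\<dots> = ennreal L * D"
      proof -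
        interpret sigma_finite_measure "lebesgue_on \<Omega>" by fact
        have [measurable]: "(\<lambda>x. x) \<in> lebesgue_on \<Omega> \<rightarrow>\<^sub>M borel"
          using id_borel_measurable_lebesgue_on[of \<Omega>] by (simp add: id_def)
        show ?thesis
          unfolding D_def by (simp add: nn_integral_cmult)
      qed
      also have "\<dots> \<le> ennreal L * W"
        by (intro mult_left_mono DF) simp
      finally show "(\<integral>\<^sup>+x. \<integral>\<^sup>+y. K x y * ennreal (\<bar>f x - f y\<bar> powr p) \<partial>lebesgue_on \<Omega> \<partial>lebesgue_on \<Omega>)
          \<le> ennreal L * W" .
      have "(\<integral>\<^sup>+x. ennreal (\<bar>f x\<bar> powr p) * u x * indicator {x. \<delta> \<le> bdist \<Omega> x} x \<partial>lebesgue_on \<Omega>)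
          \<le> ennreal (\<delta> powr (- \<theta>)) * F"
        using \<delta>(1) by (intro trunc) auto
      also have "\<dots> \<le> ennreal (\<delta> powr (- \<theta>)) * W"
        by (intro mult_left_mono DF) simp
      finally show "(\<integral>\<^sup>+x. ennreal (\<bar>f x\<bar> powr p) * u x * indicator {x. \<delta> \<le> bdist \<Omega> x} x \<partial>lebesgue_on \<Omega>)
          \<le> ennreal (\<delta> powr (- \<theta>)) * W" .
    qed auto
    also have "\<dots> = ennreal c * W"
      using L by (simp add: c_def ennreal_mult ennreal_plus algebra_simps)
    finally show "(\<integral>\<^sup>+x. ennreal (\<bar>f x\<bar> powr p / bdist \<Omega> x powr \<theta>) \<partial>lebesgue_on \<Omega>)
        \<le> ennreal c * epowr (W_norm \<Omega> s p \<alpha> \<beta> f) p"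
      by (simp add: W_def)
  qed
  show ?thesis
    using c main by (auto simp: \<theta>_def)
qed

end
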